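(* Let $\ell=(\ell_1,\dots,\ell_N):\mathbb{R}^d\to\mathbb{R}^N$ have proper, lower semicontinuous components and be $C^1$ with Jacobian $\operatorname{Jac}[\ell]$ satisfying, for some constants $L_J,L_H>0$, $$\|\operatorname{Jac}[\ell](u)\|_2\le L_J,\qquad \|\operatorname{Jac}[\ell](u)-\operatorname{Jac}[\ell](v)\|_2\le L_H\|u-v\|,\qquad\forall u,v\in\mathbb{R}^d.$$ Let $g:\mathbb{R}^N\to\mathbb{R}$ be convex, proper, lower semicontinuous, and strictly increasing with respect to $(\mathbb{R}_+)^N$ in the cone-interior sense, and assume that $\operatorname{dom}(g^* )$ is bounded. Fix $(x,\tau)\in\mathbb{R}^d\times\mathbb{R}^N$ and $\alpha,c,\mu>0$, and let $(\rho,\eta)$ satisfy $$0<\rho<\frac{1}{L_J^2},\qquad 0<\eta\le1.$$ Let $z^{(j)}=(u^{(j)},\pi^{(j)})$, $j\ge0$, be the sequence generated by the primal--dual iteration with these parameters, and let $\Psi$ be the merit function (both defined in the context). Assume further that the iteration satisfies the following descent conditions for $\Psi$: there exist constants $a,b>0$ such that for all $j\ge0$ $$\Psi(z^{(j+1)})\le\Psi(z^{(j)})-a\|z^{(j+1)}-z^{(j)}\|^2\quad\text{and}\quad \operatorname{dist}\big(0,\partial\Psi(z^{(j+1)})\big)\le b\|z^{(j+1)}-z^{(j)}\|.$$ Then: (i) The sequence $\{z^{(j)}\}_{j\ge0}$ is well-defined and bounded. Moreover, $\Psi(z^{(j)})$ decreases (in the non-strict sense) with each iteration. (ii) Every cluster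 point $(\bar u,\bar\pi)$ of $\{z^{(j)}\}$ satisfies the optimality system, i.e., all limit points are first-order stationary: with $\bar p:=c(x-\alpha\bar u)$ and $\bar E:=c(\tau+\alpha\bar\pi)$, $$\bar\pi\in\partial g(\ell(\bar u)+\bar E),\qquad \bar p=\operatorname{Jac}[\ell](\bar u)^\top\bar\pi+\mu\bar u.$$ (iii) The full sequence $z^{(j)}$ converges to a single limit $(\bar u,\bar\pi)$. (iv) If, in addition, $\Psi$ has KL exponent $\theta\in[0,1)$ at $(\bar u,\bar\pi)$, then the standard rates hold: finite length, $\sum_j\|z^{(j+1)}-z^{(j)}\|<\infty$, for $\theta=0$; linear convergence of $z^{(j)}$ to $(\bar u,\bar\pi)$ for $\theta=\tfrac12$; and sublinear convergence $\|z^{(j)}-(\bar u,\bar\pi)\|=O\big(j^{-\frac{1-\theta}{2\theta-1}}\big)$ for $\theta\in(1/2,1)$.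
   Context: $\mathbb{R}_+=[0,\infty)$. "Strictly increasing with respect to $(\mathbb{R}_+)^N$ in the cone-interior sense" means $g(z)<g(y)$ whenever $z_i<y_i$ for all $i$. $g^*(\lambda)=\sup_y\{\langle\lambda,y\rangle-g(y)\}$ is the convex conjugate, $\operatorname{dom}(g^* )$ the set where it is finite, and $\partial g$ the convex subdifferential. $\operatorname{prox}_{\rho g^*}(v)=\operatorname{argmin}_\pi\{g^*(\pi)+\frac1{2\rho}\|\pi-v\|^2\}$. For a symmetric positive-definite matrix $M$, $\|r\|_M=\sqrt{r^\top Mr}$. Notation: $E(u,\pi):=c(\tau+\alpha\pi)$ and $B(u):=(\mu+\alpha c)I_d+\operatorname{Jac}[\ell](u)^\top\operatorname{Jac}[\ell](u)$. Primal--dual iteration (associated with the convex terminal cost $J(x,\tau)=\frac c2(\|x\|^2+\|\tau\|^2)$ and the $\mu$-strongly convex regularizer $R(u)=\frac\mu2\|u\|^2$): start from $u^{(0)}=x/\max(\alpha,1)$, $\pi^{(0)}=0$, and for $j=0,1,2,\dots$ set $$\pi^{(j+1)}=\operatorname{prox}_{\rho g^*}\big(\pi^{(j)}+\rho(\ell(u^{(j)})+c(\tau+\alpha\pi^{(j)}))\big),$$ $$r^{(j)}(u)=\operatorname{Jac}[\ell](u)^\top\pi^{(j+1)}+\mu u-c(x-\alpha u),\qquad u^{(j+1)}=u^{(j)}-\eta\,B(u^{(j)})^{-1}r^{(j)}(u^{(j)}).$$ The iteration is considered as an infinite sequence (no stopping test). Merit function: for $(u,\pi)\in\mathbb{R}^d\times\mathbb{R}^N$,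 $$\Psi(u,\pi):=\tfrac12\big\|\operatorname{Jac}[\ell](u)^\top\pi+\mu u-c(x-\alpha u)\big\|^2_{B(u)^{-1}}+\tfrac1{2\rho^2}\big\|\operatorname{prox}_{\rho g^*}\big(\pi+\rho(\ell(u)+E(u,\pi))\big)-\pi\big\|^2.$$ $\partial\Psi$ denotes the (limiting) subdifferential. A proper lower semicontinuous $F:\mathbb{R}^m\to\mathbb{R}\cup\{+\infty\}$ has the Kurdyka--Łojasiewicz (KL) property at $\bar z\in\operatorname{dom}(\partial F)$ if there exist $\eta_0\in(0,+\infty]$, a neighborhood $U$ of $\bar z$, and a concave $\varphi:[0,\eta_0)\to\mathbb{R}_+$, continuous on $[0,\eta_0)$, $C^1$ on $(0,\eta_0)$, with $\varphi(0)=0$ and $\varphi'(s)>0$ for $s>0$, such that for all $z\in U$ with $F(\bar z)<F(z)<F(\bar z)+\eta_0$ one has $\varphi'(F(z)-F(\bar z))\operatorname{dist}(0,\partial F(z))\ge1$. If one can take $\varphi(s)=c_0s^{1-\theta}$ for some $\theta\in[0,1)$ (with a constant $c_0>0$), $F$ has KL exponent $\theta$ at $\bar z$. *)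

theory Defs
  imports "HOL-Analysis.Analysis" "HOL-Library.Landau_Symbols"
begin

section \<open>Extended-valued functions\<close>

definition proper_fun :: "('a \<Rightarrow> ereal) \<Rightarrow> bool" where
  "proper_fun F \<longleftrightarrow> (\<forall>z. F z \<noteq> -\<infinity>) \<and> (\<exists>z. F z \<noteq> \<infinity>)"

definition lsc_fun :: "('a::topological_space \<Rightarrow> ereal) \<Rightarrow> bool" where
  "lsc_fun F \<longleftrightarrow> (\<forall>z. F z \<le> Liminf (at z) F)"

definition eff_dom :: "('a \<Rightarrow> ereal) \<Rightarrow> 'a set" where
  "eff_dom F = {z. \<bar>F z\<bar> \<noteq> \<infinity>}"

definition conjugate :: "('a::real_inner \<Rightarrow> real) \<Rightarrow> 'a \<Rightarrow> ereal" where
  "conjugate g l = (SUP y. ereal (l \<bullet> y - g y))"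

definition convex_subdiff :: "('a::real_inner \<Rightarrow> real) \<Rightarrow> 'a \<Rightarrow> 'a set" where
  "convex_subdiff g y = {p. \<forall>w. g y + p \<bullet> (w - y) \<le> g w}"

definition is_prox :: "real \<Rightarrow> ('a::real_inner \<Rightarrow> ereal) \<Rightarrow> 'a \<Rightarrow> 'a \<Rightarrow> bool" where
  "is_prox \<rho> F v p \<longleftrightarrow>
     is_arg_min (\<lambda>q. F q + ereal (1 / (2 * \<rho>) * (norm (q - v))\<^sup>2)) (\<lambda>_. True) p"

text \<open>Total function; meaningful only where the minimizer exists and is unique.\<close>
definition prox :: "real \<Rightarrow> ('a::real_inner \<Rightarrow> ereal) \<Rightarrow> 'a \<Rightarrow> 'a" where
  "prox \<rho> F v = (THE p. is_prox \<rho> F v p)"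


section \<open>Limiting subdifferential and the Kurdyka--Lojasiewicz exponent\<close>

definition frechet_subdiff :: "('a::real_inner \<Rightarrow> ereal) \<Rightarrow> 'a \<Rightarrow> 'a set" where
  "frechet_subdiff F z = {v. z \<in> eff_dom F \<and>
     0 \<le> Liminf (at z) (\<lambda>w. (F w - F z - ereal (v \<bullet> (w - z))) / ereal (norm (w - z)))}"

definition limiting_subdiff :: "('a::real_inner \<Rightarrow> ereal) \<Rightarrow> 'a \<Rightarrow> 'a set" where
  "limiting_subdiff F z = {v. z \<in> eff_dom F \<and>
     (\<exists>zs vs. zs \<longlonglongrightarrow> z \<and> (\<lambda>k. F (zs k)) \<longlonglongrightarrow> F z \<and>
       (\<forall>k. vs k \<in> frechet_subdiff F (zs k)) \<and> vs \<longlonglongrightarrow> v)}"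

text \<open>Distance from the origin, with value \<open>\<infinity>\<close> for the empty set (unlike \<open>infdist\<close>).\<close>
definition dist_zero :: "'a::real_normed_vector set \<Rightarrow> ereal" where
  "dist_zero S = (INF v\<in>S. ereal (norm v))"

text \<open>The KL property of \<open>F\<close> at \<open>zb\<close>, with \<open>\<phi>\<close> as desingularizing function.\<close>
definition KL_with :: "('a::real_inner \<Rightarrow> ereal) \<Rightarrow> 'a \<Rightarrow> (real \<Rightarrow> real) \<Rightarrow> bool" where
  "KL_with F zb \<phi> \<longleftrightarrow> limiting_subdiff F zb \<noteq> {} \<and>
     (\<exists>(\<eta>\<^sub>0::ereal) U. 0 < \<eta>\<^sub>0 \<and> open U \<and> zb \<in> U \<and>
        concave_on {s. 0 \<le> s \<and> ereal s < \<eta>\<^sub>0} \<phi> \<and>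
        continuous_on {s. 0 \<le> s \<and> ereal s < \<eta>\<^sub>0} \<phi> \<and>
        (\<forall>s. 0 \<le> s \<and> ereal s < \<eta>\<^sub>0 \<longrightarrow> 0 \<le> \<phi> s) \<and>
        (\<forall>s. 0 < s \<and> ereal s < \<eta>\<^sub>0 \<longrightarrow> \<phi> field_differentiable (at s)) \<and>
        continuous_on {s. 0 < s \<and> ereal s < \<eta>\<^sub>0} (deriv \<phi>) \<and>
        \<phi> 0 = 0 \<and>
        (\<forall>s. 0 < s \<and> ereal s < \<eta>\<^sub>0 \<longrightarrow> 0 < deriv \<phi> s) \<and>
        (\<forall>z\<in>U. F zb < F z \<and> F z < F zb + \<eta>\<^sub>0 \<longrightarrow>
           1 \<le> ereal (deriv \<phi> (real_of_ereal (F z - F zb))) * dist_zero (limiting_subdiff F z)))"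

definition KL_property :: "('a::real_inner \<Rightarrow> ereal) \<Rightarrow> 'a \<Rightarrow> bool" where
  "KL_property F zb \<longleftrightarrow> (\<exists>\<phi>. KL_with F zb \<phi>)"

definition KL_exponent :: "('a::real_inner \<Rightarrow> ereal) \<Rightarrow> 'a \<Rightarrow> real \<Rightarrow> bool" where
  "KL_exponent F zb \<theta> \<longleftrightarrow>
     0 \<le> \<theta> \<and> \<theta> < 1 \<and> (\<exists>c\<^sub>0>0. KL_with F zb (\<lambda>s. c\<^sub>0 * s powr (1 - \<theta>)))"


section \<open>Primal--dual iteration and merit function\<close>

definition mat_norm2 :: "real^'d^'n \<Rightarrow> real" where
  "mat_norm2 A = onorm (\<lambda>h. A *v h)"

definition vec_norm_wrt :: "real^'d^'d \<Rightarrow> real^'d \<Rightarrow> real" where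
  "vec_norm_wrt M r = sqrt (r \<bullet> (M *v r))"

abbreviation Jac :: "(real^'d \<Rightarrow> real^'n) \<Rightarrow> real^'d \<Rightarrow> real^'d^'n" where
  "Jac l u \<equiv> jacobian l (at u)"

definition Bmat :: "(real^'d \<Rightarrow> real^'n) \<Rightarrow> real \<Rightarrow> real \<Rightarrow> real \<Rightarrow> real^'d \<Rightarrow> real^'d^'d" where
  "Bmat l \<alpha> c \<mu> u = (\<mu> + \<alpha> * c) *\<^sub>R mat 1 + transpose (Jac l u) ** Jac l u"

definition resid :: "(real^'d \<Rightarrow> real^'n) \<Rightarrow> real^'d \<Rightarrow> real \<Rightarrow> real \<Rightarrow> real
    \<Rightarrow> real^'d \<Rightarrow> real^'n \<Rightarrow> real^'d" where
  "resid l x \<alpha> c \<mu> u p = transpose (Jac l u) *v p + \<mu> *\<^sub>R u - c *\<^sub>R (x - \<alpha> *\<^sub>R u)"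

text \<open>The point at which the proximal map of the dual step is evaluated.\<close>
definition dual_arg :: "(real^'d \<Rightarrow> real^'n) \<Rightarrow> real^'n \<Rightarrow> real \<Rightarrow> real \<Rightarrow> real
    \<Rightarrow> real^'d \<Rightarrow> real^'n \<Rightarrow> real^'n" where
  "dual_arg l \<tau> \<alpha> c \<rho> u p = p + \<rho> *\<^sub>R (l u + c *\<^sub>R (\<tau> + \<alpha> *\<^sub>R p))"

fun pd_seq :: "(real^'d \<Rightarrow> real^'n) \<Rightarrow> (real^'n \<Rightarrow> real) \<Rightarrow> real^'d \<Rightarrow> real^'n
    \<Rightarrow> real \<Rightarrow> real \<Rightarrow> real \<Rightarrow> real \<Rightarrow> real \<Rightarrow> nat \<Rightarrow> (real^'d) \<times> (real^'n)" where
  "pd_seq l g x \<tau> \<alpha> c \<mu> \<rho> \<eta> 0 = (x /\<^sub>R max \<alpha> 1, 0)"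
| "pd_seq l g x \<tau> \<alpha> c \<mu> \<rho> \<eta> (Suc j) =
     (let (u, p) = pd_seq l g x \<tau> \<alpha> c \<mu> \<rho> \<eta> j;
          p' = prox \<rho> (conjugate g) (dual_arg l \<tau> \<alpha> c \<rho> u p)
      in (u - \<eta> *\<^sub>R (matrix_inv (Bmat l \<alpha> c \<mu> u) *v resid l x \<alpha> c \<mu> u p'), p'))"

definition merit :: "(real^'d \<Rightarrow> real^'n) \<Rightarrow> (real^'n \<Rightarrow> real) \<Rightarrow> real^'d \<Rightarrow> real^'n
    \<Rightarrow> real \<Rightarrow> real \<Rightarrow> real \<Rightarrow> real \<Rightarrow> (real^'d) \<times> (real^'n) \<Rightarrow> real" where
  "merit l g x \<tau> \<alpha> c \<mu> \<rho> = (\<lambda>(u, p).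
     1 / 2 * (vec_norm_wrt (matrix_inv (Bmat l \<alpha> c \<mu> u)) (resid l x \<alpha> c \<mu> u p))\<^sup>2
     + 1 / (2 * \<rho>\<^sup>2) * (norm (prox \<rho> (conjugate g) (dual_arg l \<tau> \<alpha> c \<rho> u p) - p))\<^sup>2)"

end

theory Submission
  imports Defs "HOL-Real_Asymp.Real_Asymp"
begin

text \<open>
  The iteration makes the merit function comparable to the square of its own step length. The
  second summand of \<open>\<Psi>(z\<^sub>j)\<close> is exactly \<open>\<parallel>\<pi>\<^sub>j\<^sub>+\<^sub>1 - \<pi>\<^sub>j\<parallel>\<^sup>2 / (2 \<rho>\<^sup>2)\<close>, because \<open>\<pi>\<^sub>j\<^sub>+\<^sub>1\<close> is the
  proximal point that occurs there. In the first summand the residual is taken at \<open>(u\<^sub>j, \<pi>\<^sub>j)\<close>, which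
  differs by \<open>Jac\<^sup>T (\<pi>\<^sub>j\<^sub>+\<^sub>1 - \<pi>\<^sub>j)\<close> from the residual at \<open>(u\<^sub>j, \<pi>\<^sub>j\<^sub>+\<^sub>1)\<close>, and the primal step says that the
  latter equals \<open>- B(u\<^sub>j) (u\<^sub>j\<^sub>+\<^sub>1 - u\<^sub>j) / \<eta>\<close>. As \<open>Jac\<close> and \<open>B\<close> are bounded and \<open>B\<close> is bounded below,
  \<open>\<Psi>(z\<^sub>j) \<le> K \<parallel>z\<^sub>j\<^sub>+\<^sub>1 - z\<^sub>j\<parallel>\<^sup>2\<close> for some \<open>K\<close> (\<open>merit_le_step\<close>).

  Together with the sufficient decrease \<open>\<Psi>(z\<^sub>j\<^sub>+\<^sub>1) \<le> \<Psi>(z\<^sub>j) - a \<parallel>z\<^sub>j\<^sub>+\<^sub>1 - z\<^sub>j\<parallel>\<^sup>2\<close> this gives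
  \<open>\<Psi>(z\<^sub>j\<^sub>+\<^sub>1) \<le> (1 - a/K) \<Psi>(z\<^sub>j)\<close>, so \<open>\<Psi>(z\<^sub>j)\<close> and with it the step lengths decay geometrically and the
  whole sequence converges at a linear rate (\<open>comparable_descent_linear_convergence\<close>).
  Boundedness, the single limit and finite length follow, and so do the rates, since geometric
  decay is faster than every power of \<open>j\<close>.

  Stationarity of the limit is continuity of the two update equations. For the dual one, the
  proximal point \<open>p\<close> of \<open>g\<^sup>*\<close> at \<open>v\<close> is described by Moreau's decomposition: minimizing
  \<open>g + (\<rho>/2) \<parallel>\<cdot> - v/\<rho>\<parallel>\<^sup>2\<close> yields \<open>y\<close> such that \<open>p = v - \<rho> y\<close> is a subgradient of \<open>g\<close> at \<open>y\<close>, and such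
  a \<open>p\<close> is the unique proximal point (\<open>prox_conjugate\<close>). The relation \<open>p \<in> \<partial>g((v - p)/\<rho>)\<close> is
  closed under limits since \<open>g\<close>, being finite and convex, is continuous.
\<close>

section \<open>Proximal points of a conjugate function\<close>

text \<open>
  Convexity along the ray from the centre shows that \<open>g\<close> falls at most linearly, so the quadratic
  term dominates outside a large ball and the minimum over that ball is global.
\<close>

lemma convex_plus_quadratic_attains_min:
  fixes g :: "'a::euclidean_space \<Rightarrow> real"
  assumes g: "convex_on UNIV g" and \<rho>: "0 < \<rho>"
  obtains y where "\<And>y'. g y + \<rho> / 2 * (norm (y - w))\<^sup>2 \<le> g y' + \<rho> / 2 * (norm (y' - w))\<^sup>2"
proof -
  have cont: "continuous_on A g" for A
    using convex_on_continuous[OF open_UNIV g] continuous_on_subset by blast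
  obtain m where m: "m \<in> cball w 1" "\<And>y. y \<in> cball w 1 \<Longrightarrow> g m \<le> g y"
    using continuous_attains_inf[of "cball w 1" g] cont by auto
  define M where "M = g w - g m"
  have M: "0 \<le> M" using m(2)[of w] by (simp add: M_def)
  define R where "R = max 1 (2 * M / \<rho>)"
  define h where "h y = g y + \<rho> / 2 * (norm (y - w))\<^sup>2" for y
  have "continuous_on (cball w R) h"
    unfolding h_def by (intro continuous_intros cont)
  moreover have "w \<in> cball w R" by (simp add: R_def)
  ultimately obtain y where y: "\<And>y'. y' \<in> cball w R \<Longrightarrow> h y \<le> h y'"
    using continuous_attains_inf[OF compact_cball] by (metis empty_iff)
  have "h y \<le> h y'" if out: "y' \<notin> cball w R" for y'
  proof -
    define t where "t = norm (y' - w)"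
    have t: "1 < t" "2 * M / \<rho> < t"
      using out by (auto simp: R_def t_def dist_norm norm_minus_commute)
    have "norm ((1 / t) *\<^sub>R (y' - w)) = 1"
      using t by (simp add: t_def[symmetric])
    then have "(1 - 1 / t) *\<^sub>R w + (1 / t) *\<^sub>R y' \<in> cball w 1"
      by (simp add: dist_norm norm_minus_commute algebra_simps)
    then have "g m \<le> g ((1 - 1 / t) *\<^sub>R w + (1 / t) *\<^sub>R y')" by (rule m(2))
    also have "\<dots> \<le> (1 - 1 / t) * g w + (1 / t) * g y'"
      using t by (intro convex_onD[OF g]) auto
    finally have "t * g m \<le> t * ((1 - 1 / t) * g w + (1 / t) * g y')"
      using t by (intro mult_left_mono) auto
    also have "\<dots> = t * g w - g w + g y'"
      using t by (simp add: field_simps)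
    finally have low: "g w - t * M \<le> g y'" by (simp add: M_def algebra_simps)
    have "2 * M < \<rho> * t" using t(2) \<rho> by (simp add: field_simps)
    then have "2 * M * t \<le> \<rho> * t * t" using t by (intro mult_right_mono) auto
    then have "t * M \<le> \<rho> / 2 * t\<^sup>2" by (simp add: power2_eq_square algebra_simps)
    then have "h w \<le> h y'" using low by (simp add: h_def t_def)
    moreover have "h y \<le> h w" by (intro y) (simp add: R_def)
    ultimately show ?thesis by simp
  qed
  then have "h y \<le> h y'" for y' using y by blast
  then show thesis using that unfolding h_def by blast
qed

lemma subgradient_at_min_plus_quadratic:
  fixes g :: "'a::real_inner \<Rightarrow> real"
  assumes g: "convex_on UNIV g"
    and min: "\<And>y'. g y + \<rho> / 2 * (norm (y - w))\<^sup>2 \<le> g y' + \<rho> / 2 * (norm (y' - w))\<^sup>2"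
  shows "\<rho> *\<^sub>R (w - y) \<in> convex_subdiff g y"
  unfolding convex_subdiff_def
proof (intro CollectI allI)
  fix y'
  define e where "e = y' - y"
  have step: "(\<rho> *\<^sub>R (w - y)) \<bullet> e - \<rho> / 2 * (norm e)\<^sup>2 * t \<le> g y' - g y"
    if t: "0 < t" "t < 1" for t
  proof -
    have eq: "y + t *\<^sub>R e = (1 - t) *\<^sub>R y + t *\<^sub>R y'" by (simp add: e_def algebra_simps)
    have "g (y + t *\<^sub>R e) \<le> (1 - t) * g y + t * g y'"
      unfolding eq using t by (intro convex_onD[OF g]) auto
    moreover have "(norm (y + t *\<^sub>R e - w))\<^sup>2
        = (norm (y - w))\<^sup>2 - 2 * t * ((w - y) \<bullet> e) + t * t * (norm e)\<^sup>2"
      unfolding power2_norm_eq_inner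
      by (simp add: inner_add_left inner_add_right inner_diff_left inner_diff_right
          inner_commute algebra_simps)
    ultimately have "g y + \<rho> / 2 * (norm (y - w))\<^sup>2 \<le> (1 - t) * g y + t * g y'
        + \<rho> / 2 * ((norm (y - w))\<^sup>2 - 2 * t * ((w - y) \<bullet> e) + t * t * (norm e)\<^sup>2)"
      using min[of "y + t *\<^sub>R e"] by simp
    then have "t * (\<rho> * ((w - y) \<bullet> e) - \<rho> / 2 * (norm e)\<^sup>2 * t) \<le> t * (g y' - g y)"
      by (simp add: algebra_simps)
    then show ?thesis using t by simp
  qed
  have "((\<lambda>t. (\<rho> *\<^sub>R (w - y)) \<bullet> e - \<rho> / 2 * (norm e)\<^sup>2 * t)
      \<longlongrightarrow> (\<rho> *\<^sub>R (w - y)) \<bullet> e - \<rho> / 2 * (norm e)\<^sup>2 * 0) (at_right 0)"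
    by (intro tendsto_intros)
  moreover have "\<forall>\<^sub>F t in at_right 0. (\<rho> *\<^sub>R (w - y)) \<bullet> e - \<rho> / 2 * (norm e)\<^sup>2 * t \<le> g y' - g y"
    by (rule eventually_mono[OF eventually_at_right_real[OF zero_less_one]]) (rule step, simp_all)
  ultimately have "(\<rho> *\<^sub>R (w - y)) \<bullet> e - \<rho> / 2 * (norm e)\<^sup>2 * 0 \<le> g y' - g y"
    by (rule tendsto_upperbound) simp
  then show "g y + (\<rho> *\<^sub>R (w - y)) \<bullet> (y' - y) \<le> g y'" by (simp add: e_def)
qed

text \<open>
  Testing the supremum that defines \<open>g\<^sup>*(q)\<close> at the single point \<open>y = (v - p)/\<rho>\<close>, where it is attained
  for \<open>q = p\<close>, already shows that the proximal objective at \<open>q\<close> exceeds its value at \<open>p\<close> by at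
  least \<open>\<parallel>q - p\<parallel>\<^sup>2 / (2 \<rho>)\<close>. This gives minimality and uniqueness at once, without recourse to the biconjugate.
\<close>

lemma subgradient_imp_unique_prox:
  fixes g :: "'a::real_inner \<Rightarrow> real"
  assumes \<rho>: "0 < \<rho>" and p: "p \<in> convex_subdiff g ((v - p) /\<^sub>R \<rho>)"
  shows "is_prox \<rho> (conjugate g) v p" and "is_prox \<rho> (conjugate g) v q \<Longrightarrow> q = p"
proof -
  define y where "y = (v - p) /\<^sub>R \<rho>"
  have v: "v = p + \<rho> *\<^sub>R y" using \<rho> by (simp add: y_def)
  have sub: "g y + p \<bullet> (w - y) \<le> g w" for w
    using p by (simp add: convex_subdiff_def y_def)
  have lower: "ereal (q \<bullet> y - g y) \<le> conjugate g q" for q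
    unfolding conjugate_def by (rule SUP_upper) simp
  have at_p: "conjugate g p = ereal (p \<bullet> y - g y)"
  proof (rule antisym[OF _ lower])
    show "conjugate g p \<le> ereal (p \<bullet> y - g y)"
      unfolding conjugate_def
      by (rule SUP_least) (use sub in \<open>simp add: inner_diff_right algebra_simps\<close>)
  qed
  define F where "F q = conjugate g q + ereal (1 / (2 * \<rho>) * (norm (q - v))\<^sup>2)" for q
  have growth: "F p + ereal (1 / (2 * \<rho>) * (norm (q - p))\<^sup>2) \<le> F q" for q
  proof -
    have "(norm (q - v))\<^sup>2 = (norm (p - v))\<^sup>2 - 2 * \<rho> * ((q - p) \<bullet> y) + (norm (q - p))\<^sup>2"
      unfolding power2_norm_eq_inner v
      by (simp add: inner_add_left inner_add_right inner_diff_left inner_diff_right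
          inner_commute algebra_simps)
    then have "(p \<bullet> y - g y) + 1 / (2 * \<rho>) * (norm (p - v))\<^sup>2 + 1 / (2 * \<rho>) * (norm (q - p))\<^sup>2
        = (q \<bullet> y - g y) + 1 / (2 * \<rho>) * (norm (q - v))\<^sup>2"
      using \<rho> by (simp add: inner_diff_left field_simps)
    then have "F p + ereal (1 / (2 * \<rho>) * (norm (q - p))\<^sup>2)
        = ereal (q \<bullet> y - g y) + ereal (1 / (2 * \<rho>) * (norm (q - v))\<^sup>2)"
      by (simp add: F_def at_p)
    also have "\<dots> \<le> F q" unfolding F_def by (intro add_right_mono lower)
    finally show ?thesis .
  qed
  obtain Fp where Fp: "F p = ereal Fp" by (simp add: F_def at_p)
  have nn: "0 \<le> 1 / (2 * \<rho>) * (norm (q - p))\<^sup>2" for q using \<rho> by simp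
  have le: "F p \<le> F q" for q
  proof -
    have "F p \<le> F p + ereal (1 / (2 * \<rho>) * (norm (q - p))\<^sup>2)" using nn[of q] by (simp add: Fp)
    then show ?thesis using growth[of q] by (rule order_trans)
  qed
  show "is_prox \<rho> (conjugate g) v p"
    using le unfolding is_prox_def is_arg_min_def F_def by (auto simp flip: not_le)
  assume "is_prox \<rho> (conjugate g) v q"
  then have "F q \<le> F p"
    unfolding is_prox_def is_arg_min_def F_def by (auto simp: not_less)
  then have "F p + ereal (1 / (2 * \<rho>) * (norm (q - p))\<^sup>2) \<le> F p"
    using growth[of q] order_trans by blast
  then have "1 / (2 * \<rho>) * (norm (q - p))\<^sup>2 \<le> 0" by (simp add: Fp)
  then show "q = p" using \<rho> by (simp add: mult_le_0_iff divide_le_0_iff)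
qed

lemma prox_conjugate:
  fixes g :: "'a::euclidean_space \<Rightarrow> real"
  assumes g: "convex_on UNIV g" and \<rho>: "0 < \<rho>"
  shows "\<exists>!p. is_prox \<rho> (conjugate g) v p"
    and "prox \<rho> (conjugate g) v \<in> convex_subdiff g ((v - prox \<rho> (conjugate g) v) /\<^sub>R \<rho>)"
proof -
  obtain y where y: "\<And>y'. g y + \<rho> / 2 * (norm (y - v /\<^sub>R \<rho>))\<^sup>2
      \<le> g y' + \<rho> / 2 * (norm (y' - v /\<^sub>R \<rho>))\<^sup>2"
    using convex_plus_quadratic_attains_min[OF g \<rho>] by blast
  define p where "p = \<rho> *\<^sub>R (v /\<^sub>R \<rho> - y)"
  have y_eq: "(v - p) /\<^sub>R \<rho> = y" using \<rho> by (simp add: p_def scaleR_diff_right)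
  have p: "p \<in> convex_subdiff g ((v - p) /\<^sub>R \<rho>)"
    unfolding y_eq unfolding p_def by (rule subgradient_at_min_plus_quadratic[OF g y])
  show ex1: "\<exists>!p. is_prox \<rho> (conjugate g) v p"
    using subgradient_imp_unique_prox[OF \<rho> p] by blast
  have "prox \<rho> (conjugate g) v = p"
    unfolding prox_def by (intro the_equality subgradient_imp_unique_prox[OF \<rho> p])
  then show "prox \<rho> (conjugate g) v \<in> convex_subdiff g ((v - prox \<rho> (conjugate g) v) /\<^sub>R \<rho>)"
    using p by simp
qed

lemma convex_subdiff_closed_graph:
  fixes g :: "'a::euclidean_space \<Rightarrow> real"
  assumes g: "convex_on UNIV g" and lim: "p \<longlonglongrightarrow> p'" "y \<longlonglongrightarrow> y'"
    and sub: "\<And>j. p j \<in> convex_subdiff g (y j)"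
  shows "p' \<in> convex_subdiff g y'"
  unfolding convex_subdiff_def
proof (intro CollectI allI)
  fix w
  have "isCont g y'"
    using convex_on_continuous[OF open_UNIV g] by (simp add: continuous_on_eq_continuous_at)
  then have "(\<lambda>j. g (y j)) \<longlonglongrightarrow> g y'" using lim(2) by (rule isCont_tendsto_compose)
  then have "(\<lambda>j. g (y j) + p j \<bullet> (w - y j)) \<longlonglongrightarrow> g y' + p' \<bullet> (w - y')"
    by (intro tendsto_intros lim)
  moreover have "g (y j) + p j \<bullet> (w - y j) \<le> g w" for j
    using sub[of j] by (simp add: convex_subdiff_def)
  ultimately show "g y' + p' \<bullet> (w - y') \<le> g w"
    by (intro LIMSEQ_le_const2) auto
qed

section \<open>The preconditioner\<close>

lemma norm_matrix_vector_le_mat_norm2: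
  fixes A :: "real^'d^'n"
  shows "norm (A *v h) \<le> mat_norm2 A * norm h"
  unfolding mat_norm2_def by (intro onorm matrix_vector_mul_bounded_linear)

lemma norm_transpose_vector_le:
  fixes A :: "real^'d^'n"
  assumes A: "\<And>h. norm (A *v h) \<le> L * norm h"
  shows "norm (transpose A *v p) \<le> L * norm p"
proof (cases "transpose A *v p = 0")
  case True
  have "0 \<le> L"
    using order_trans[OF norm_ge_zero A[of "axis undefined 1"]] by simp
  then show ?thesis using True by simp
next
  case False
  define s where "s = transpose A *v p"
  have "norm s * norm s = p \<bullet> (A *v s)"
    by (simp add: s_def dot_lmul_matrix[symmetric] transpose_matrix_vector power2_norm_eq_inner[symmetric] power2_eq_square[symmetric])
  also have "\<dots> \<le> norm p * norm (A *v s)" by (rule norm_cauchy_schwarz)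
  also have "\<dots> \<le> norm p * (L * norm s)" by (intro mult_left_mono A) simp
  finally have "norm s * norm s \<le> (L * norm p) * norm s" by (simp add: mult_ac)
  then show ?thesis using False by (simp add: s_def)
qed

lemma Bmat_mult_vec:
  "Bmat l \<alpha> c \<mu> u *v h = (\<mu> + \<alpha> * c) *\<^sub>R h + transpose (Jac l u) *v (Jac l u *v h)"
  by (simp add: Bmat_def matrix_vector_mult_add_rdistrib scaleR_matrix_vector_assoc[symmetric]
      matrix_vector_mul_assoc)

lemma Bmat_coercive:
  "(\<mu> + \<alpha> * c) * (norm h)\<^sup>2 \<le> h \<bullet> (Bmat l \<alpha> c \<mu> u *v h)"
proof -
  have "h \<bullet> (transpose (Jac l u) *v (Jac l u *v h)) = (norm (Jac l u *v h))\<^sup>2"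
    by (metis dot_lmul_matrix transpose_matrix_vector inner_commute power2_norm_eq_inner)
  then show ?thesis
    by (simp add: Bmat_mult_vec inner_add_right power2_norm_eq_inner)
qed

lemma invertible_Bmat:
  assumes "0 < \<mu> + \<alpha> * c"
  shows "invertible (Bmat l \<alpha> c \<mu> u)"
proof -
  have "h = 0" if "Bmat l \<alpha> c \<mu> u *v h = 0" for h
    using Bmat_coercive[of \<mu> \<alpha> c h l u] that assms by (simp add: mult_le_0_iff)
  then show ?thesis
    by (simp add: invertible_left_inverse matrix_left_invertible_ker)
qed

lemma Bmat_matrix_inv_mult:
  assumes "0 < \<mu> + \<alpha> * c"
  shows "Bmat l \<alpha> c \<mu> u *v (matrix_inv (Bmat l \<alpha> c \<mu> u) *v r) = r"
proof -
  have "Bmat l \<alpha> c \<mu> u ** matrix_inv (Bmat l \<alpha> c \<mu> u) = mat 1"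
    using someI_ex[OF invertible_Bmat[OF assms, of l u, unfolded invertible_def]]
    by (simp add: matrix_inv_def)
  then show ?thesis by (simp add: matrix_vector_mul_assoc)
qed

lemma norm_Bmat_mult_le:
  assumes J: "\<And>h. norm (Jac l u *v h) \<le> L * norm h" and L: "0 \<le> L" and k: "0 < \<mu> + \<alpha> * c"
  shows "norm (Bmat l \<alpha> c \<mu> u *v h) \<le> (\<mu> + \<alpha> * c + L\<^sup>2) * norm h"
proof -
  have "norm (transpose (Jac l u) *v (Jac l u *v h)) \<le> L * norm (Jac l u *v h)"
    by (rule norm_transpose_vector_le[OF J])
  also have "\<dots> \<le> L * (L * norm h)" by (intro mult_left_mono J L)
  finally have "norm (Bmat l \<alpha> c \<mu> u *v h) \<le> norm ((\<mu> + \<alpha> * c) *\<^sub>R h) + L * (L * norm h)"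
    unfolding Bmat_mult_vec by (meson norm_triangle_le add_left_mono)
  also have "\<dots> = (\<mu> + \<alpha> * c + L\<^sup>2) * norm h"
    using k by (simp add: distrib_right power2_eq_square flip: scaleR_left_distrib)
  finally show ?thesis .
qed

text \<open>
  With \<open>r = B s\<close> the squared norm is \<open>B s \<bullet> s \<ge> k \<parallel>s\<parallel>\<^sup>2\<close> for the coercivity constant \<open>k\<close>, which yields
  the sign of \<open>r \<bullet> B\<^sup>-\<^sup>1 r\<close> that the square root in the definition needs, and \<open>\<parallel>s\<parallel> \<le> \<parallel>r\<parallel> / k\<close>.
\<close>

lemma vec_norm_wrt_inv_Bmat_le:
  assumes k: "0 < \<mu> + \<alpha> * c"
  shows "(vec_norm_wrt (matrix_inv (Bmat l \<alpha> c \<mu> u)) r)\<^sup>2 \<le> (norm r)\<^sup>2 / (\<mu> + \<alpha> * c)"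
proof -
  define s where "s = matrix_inv (Bmat l \<alpha> c \<mu> u) *v r"
  have "Bmat l \<alpha> c \<mu> u *v s = r" unfolding s_def by (rule Bmat_matrix_inv_mult[OF k])
  then have coercive: "(\<mu> + \<alpha> * c) * (norm s)\<^sup>2 \<le> r \<bullet> s"
    using Bmat_coercive[of \<mu> \<alpha> c s l u] by (simp add: inner_commute)
  have cs: "r \<bullet> s \<le> norm r * norm s" by (rule norm_cauchy_schwarz)
  have "0 \<le> (\<mu> + \<alpha> * c) * (norm s)\<^sup>2" using k by simp
  then have "(vec_norm_wrt (matrix_inv (Bmat l \<alpha> c \<mu> u)) r)\<^sup>2 = r \<bullet> s"
    using coercive by (simp add: vec_norm_wrt_def s_def[symmetric])
  also have "\<dots> \<le> norm r * (norm r / (\<mu> + \<alpha> * c))"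
  proof -
    have "norm s * ((\<mu> + \<alpha> * c) * norm s) \<le> norm s * norm r"
      using coercive cs by (simp add: power2_eq_square mult_ac)
    then have "(\<mu> + \<alpha> * c) * norm s \<le> norm r"
      by (cases "s = 0") auto
    then have "norm s \<le> norm r / (\<mu> + \<alpha> * c)" using k by (simp add: pos_le_divide_eq mult_ac)
    then show ?thesis using cs by (meson mult_left_mono norm_ge_zero order_trans)
  qed
  finally show ?thesis by (simp add: power2_eq_square)
qed

section \<open>The merit function along the iteration\<close>

text \<open>
  The primal step is solved for its residual, because both the comparison of the merit function
  with the step length and the stationarity of limits need the residual in terms of the step.
\<close>

lemma pd_seq_Suc:
  fixes l :: "real^'d \<Rightarrow> real^'n"
  assumes k: "0 < \<mu> + \<alpha> * c" and \<eta>: "\<eta> \<noteq> 0"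
    and z: "z = pd_seq l g x \<tau> \<alpha> c \<mu> \<rho> \<eta>"
  shows "snd (z (Suc j)) = prox \<rho> (conjugate g) (dual_arg l \<tau> \<alpha> c \<rho> (fst (z j)) (snd (z j)))"
    and "resid l x \<alpha> c \<mu> (fst (z j)) (snd (z (Suc j)))
        = (- 1 / \<eta>) *\<^sub>R (Bmat l \<alpha> c \<mu> (fst (z j)) *v (fst (z (Suc j)) - fst (z j)))"
proof -
  show dual: "snd (z (Suc j)) = prox \<rho> (conjugate g) (dual_arg l \<tau> \<alpha> c \<rho> (fst (z j)) (snd (z j)))"
    by (simp add: z split_beta Let_def)
  have "fst (z (Suc j)) - fst (z j) = - \<eta> *\<^sub>R (matrix_inv (Bmat l \<alpha> c \<mu> (fst (z j)))
      *v resid l x \<alpha> c \<mu> (fst (z j)) (snd (z (Suc j))))"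
    unfolding dual by (simp add: z split_beta Let_def)
  then show "resid l x \<alpha> c \<mu> (fst (z j)) (snd (z (Suc j)))
      = (- 1 / \<eta>) *\<^sub>R (Bmat l \<alpha> c \<mu> (fst (z j)) *v (fst (z (Suc j)) - fst (z j)))"
    using \<eta> by (simp add: matrix_vector_mult_scaleR Bmat_matrix_inv_mult[OF k]
      flip: scaleR_minus_left)
qed

lemma merit_nonneg: "0 \<le> merit l g x \<tau> \<alpha> c \<mu> \<rho> w"
  by (simp add: merit_def split_beta)

lemma merit_le_step:
  fixes l :: "real^'d \<Rightarrow> real^'n"
  assumes k: "0 < \<mu> + \<alpha> * c" and \<eta>: "0 < \<eta>" and L: "0 \<le> L"
    and J: "\<And>u h. norm (Jac l u *v h) \<le> L * norm h"
    and z: "z = pd_seq l g x \<tau> \<alpha> c \<mu> \<rho> \<eta>"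
  defines "K \<equiv> ((\<mu> + \<alpha> * c + L\<^sup>2) / \<eta> + L)\<^sup>2 / (2 * (\<mu> + \<alpha> * c)) + 1 / (2 * \<rho>\<^sup>2)"
  shows "merit l g x \<tau> \<alpha> c \<mu> \<rho> (z j) \<le> K * (norm (z (Suc j) - z j))\<^sup>2"
proof -
  define u p u' p' where "u = fst (z j)" and "p = snd (z j)"
    and "u' = fst (z (Suc j))" and "p' = snd (z (Suc j))"
  define D where "D = norm (z (Suc j) - z j)"
  have du: "norm (u' - u) \<le> D" and dp: "norm (p' - p) \<le> D"
    unfolding u'_def u_def p'_def p_def D_def fst_diff[symmetric] snd_diff[symmetric]
    by (metis norm_fst_le prod.collapse, metis norm_snd_le prod.collapse)
  define M where "M = (\<mu> + \<alpha> * c + L\<^sup>2) / \<eta> + L"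
  note upd = pd_seq_Suc[OF k _ z, of j, folded u_def p_def u'_def p'_def]
  have p': "prox \<rho> (conjugate g) (dual_arg l \<tau> \<alpha> c \<rho> u p) = p'" using upd(1) \<eta> by simp
  have "resid l x \<alpha> c \<mu> u p = resid l x \<alpha> c \<mu> u p' - transpose (Jac l u) *v (p' - p)"
    by (simp add: resid_def matrix_vector_mult_diff_distrib)
  then have "norm (resid l x \<alpha> c \<mu> u p)
      \<le> norm (resid l x \<alpha> c \<mu> u p') + norm (transpose (Jac l u) *v (p' - p))"
    by (simp add: norm_triangle_ineq4)
  also have "norm (resid l x \<alpha> c \<mu> u p') = norm (Bmat l \<alpha> c \<mu> u *v (u' - u)) / \<eta>"
    using upd(2) \<eta> by simp
  also have "norm (Bmat l \<alpha> c \<mu> u *v (u' - u)) / \<eta> \<le> (\<mu> + \<alpha> * c + L\<^sup>2) * D / \<eta>"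
  proof -
    have "norm (Bmat l \<alpha> c \<mu> u *v (u' - u)) \<le> (\<mu> + \<alpha> * c + L\<^sup>2) * norm (u' - u)"
      by (rule norm_Bmat_mult_le[OF J L k])
    also have "\<dots> \<le> (\<mu> + \<alpha> * c + L\<^sup>2) * D" using k du by (intro mult_left_mono) auto
    finally show ?thesis using \<eta> by (simp add: divide_right_mono)
  qed
  also have "norm (transpose (Jac l u) *v (p' - p)) \<le> L * D"
    by (meson norm_transpose_vector_le[OF J] mult_left_mono dp L order_trans)
  finally have "norm (resid l x \<alpha> c \<mu> u p) \<le> M * D"
    by (simp add: M_def algebra_simps)
  then have "(norm (resid l x \<alpha> c \<mu> u p))\<^sup>2 \<le> (M * D)\<^sup>2"
    by (intro power_mono) auto
  then have "(norm (resid l x \<alpha> c \<mu> u p))\<^sup>2 / (\<mu> + \<alpha> * c)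
      \<le> (M * D)\<^sup>2 / (\<mu> + \<alpha> * c)"
    using k by (simp add: divide_right_mono)
  then have primal: "1 / 2 * (vec_norm_wrt (matrix_inv (Bmat l \<alpha> c \<mu> u)) (resid l x \<alpha> c \<mu> u p))\<^sup>2
      \<le> 1 / 2 * ((M * D)\<^sup>2 / (\<mu> + \<alpha> * c))"
    using vec_norm_wrt_inv_Bmat_le[OF k, of l u "resid l x \<alpha> c \<mu> u p"] by linarith
  have dual: "1 / (2 * \<rho>\<^sup>2) * (norm (p' - p))\<^sup>2 \<le> 1 / (2 * \<rho>\<^sup>2) * D\<^sup>2"
    using dp by (intro mult_left_mono power_mono) auto
  have "merit l g x \<tau> \<alpha> c \<mu> \<rho> (z j)
      = 1 / 2 * (vec_norm_wrt (matrix_inv (Bmat l \<alpha> c \<mu> u)) (resid l x \<alpha> c \<mu> u p))\<^sup>2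
        + 1 / (2 * \<rho>\<^sup>2) * (norm (p' - p))\<^sup>2"
    by (simp add: merit_def split_beta u_def[symmetric] p_def[symmetric] p')
  also have "\<dots> \<le> 1 / 2 * ((M * D)\<^sup>2 / (\<mu> + \<alpha> * c))
      + 1 / (2 * \<rho>\<^sup>2) * D\<^sup>2"
    using primal dual by (rule add_mono)
  also have "\<dots> = K * D\<^sup>2"
    by (simp add: K_def M_def[symmetric] power_mult_distrib distrib_right)
  finally show ?thesis by (simp add: D_def)
qed

section \<open>Linear convergence\<close>

lemma geometric_steps_converge:
  fixes z :: "nat \<Rightarrow> 'a::banach"
  assumes step: "\<And>j. norm (z (Suc j) - z j) \<le> C * q ^ j" and q: "0 \<le> q" "q < 1"
  obtains zb where "z \<longlonglongrightarrow> zb" "\<And>j. norm (z j - zb) \<le> C / (1 - q) * q ^ j"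
proof -
  have geo: "summable (\<lambda>i. C * q ^ i)" using q by (intro summable_mult summable_geometric) simp
  have sum: "summable (\<lambda>i. norm (z (Suc i) - z i))"
    by (rule summable_comparison_test'[OF geo]) (simp add: step)
  then have "summable (\<lambda>i. z (Suc i) - z i)" by (rule summable_norm_cancel)
  then have "convergent (\<lambda>n. z n - z 0)"
    by (simp add: summable_iff_convergent sum_lessThan_telescope)
  then obtain e where "(\<lambda>n. z n - z 0) \<longlonglongrightarrow> e" by (auto simp: convergent_def)
  then have "(\<lambda>n. (z n - z 0) + z 0) \<longlonglongrightarrow> e + z 0" by (intro tendsto_intros)
  then have lim: "z \<longlonglongrightarrow> e + z 0" by simp
  define M where "M = C / (1 - q)"
  have C: "C = M * (1 - q)" using q by (simp add: M_def)
  have "norm (z j - (e + z 0)) \<le> M * q ^ j" for j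
  proof -
    have "norm (z j - z n) \<le> M * q ^ j" if "j \<le> n" for n
    proof -
      have "norm (z n - z j) \<le> (\<Sum>i=j..<n. norm (z (Suc i) - z i))"
        unfolding sum_Suc_diff'[OF that, of z, symmetric] by (rule norm_sum)
      also have "\<dots> \<le> (\<Sum>i=j..<n. C * q ^ i)" by (intro sum_mono step)
      also have "\<dots> = (\<Sum>i=j..<n. - M * q ^ Suc i - - M * q ^ i)"
        by (simp add: C algebra_simps)
      also have "\<dots> = M * (q ^ j - q ^ n)"
        unfolding sum_Suc_diff'[OF that, of "\<lambda>i. - M * q ^ i"]
        by (simp add: algebra_simps)
      also have "\<dots> \<le> M * q ^ j"
      proof (intro mult_left_mono)
        have "0 \<le> C" using order_trans[OF norm_ge_zero step[of 0]] by simp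
        then show "0 \<le> M" using q by (simp add: M_def)
      qed (use q in simp)
      finally show ?thesis by (simp add: norm_minus_commute)
    qed
    moreover have "(\<lambda>n. norm (z j - z n)) \<longlonglongrightarrow> norm (z j - (e + z 0))"
      by (intro tendsto_intros lim)
    ultimately show ?thesis by (intro LIMSEQ_le_const2) auto
  qed
  with lim show thesis unfolding M_def by (rule that)
qed

text \<open>
  Sufficient decrease bounds the squared step by the current value of \<open>\<psi>\<close>; the reverse comparison
  turns it into the contraction \<open>\<psi> (Suc j) \<le> Q \<psi> j\<close>. Writing the decrease against \<open>K + a\<close> rather
  than \<open>K\<close> keeps \<open>Q = K / (K + a)\<close> strictly between 0 and 1.
\<close>

lemma comparable_descent_linear_convergence:
  fixes z :: "nat \<Rightarrow> 'a::banach" and \<psi> :: "nat \<Rightarrow> real"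
  assumes nonneg: "\<And>j. 0 \<le> \<psi> j" and a: "0 < a" and K: "0 < K"
    and descent: "\<And>j. \<psi> (Suc j) \<le> \<psi> j - a * (norm (z (Suc j) - z j))\<^sup>2"
    and comparable: "\<And>j. \<psi> j \<le> K * (norm (z (Suc j) - z j))\<^sup>2"
  obtains zb C q where "0 < q" "q < 1" "z \<longlonglongrightarrow> zb" "\<And>j. norm (z j - zb) \<le> C * q ^ j"
    "summable (\<lambda>j. norm (z (Suc j) - z j))"
proof -
  define Q where "Q = K / (K + a)"
  define q where "q = sqrt Q"
  have Q: "0 < Q" "Q < 1" using a K by (simp_all add: Q_def)
  have q: "0 < q" "q < 1" using Q by (simp_all add: q_def)
  have contract: "\<psi> (Suc j) \<le> Q * \<psi> j" for j
  proof -
    define S where "S = (norm (z (Suc j) - z j))\<^sup>2"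
    have "\<psi> j \<le> (K + a) * S"
      using comparable[of j] a by (simp add: S_def distrib_right add_increasing2)
    then have "a * (\<psi> j / (K + a)) \<le> a * S"
      using a K by (intro mult_left_mono) (simp_all add: field_simps)
    moreover have "Q * \<psi> j = \<psi> j - a * (\<psi> j / (K + a))"
      using a K by (simp add: Q_def field_simps)
    ultimately show ?thesis using descent[of j] by (simp add: S_def)
  qed
  have \<psi>: "\<psi> j \<le> Q ^ j * \<psi> 0" for j
  proof (induction j)
    case (Suc j)
    have "\<psi> (Suc j) \<le> Q * (Q ^ j * \<psi> 0)"
      using contract[of j] Suc Q by (meson mult_left_mono less_imp_le order_trans)
    then show ?case by simp
  qed simp
  define C where "C = sqrt (\<psi> 0 / a)"
  have step: "norm (z (Suc j) - z j) \<le> C * q ^ j" for j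
  proof -
    have "a * (norm (z (Suc j) - z j))\<^sup>2 \<le> Q ^ j * \<psi> 0"
      using descent[of j] nonneg[of "Suc j"] \<psi>[of j] by linarith
    then have "(norm (z (Suc j) - z j))\<^sup>2 \<le> (\<psi> 0 / a) * Q ^ j"
      using a by (simp add: field_simps)
    then have "norm (z (Suc j) - z j) \<le> sqrt ((\<psi> 0 / a) * Q ^ j)"
      by (rule real_le_rsqrt)
    then show ?thesis by (simp only: C_def q_def real_sqrt_mult real_sqrt_power)
  qed
  obtain zb where zb: "z \<longlonglongrightarrow> zb" "\<And>j. norm (z j - zb) \<le> C / (1 - q) * q ^ j"
    using geometric_steps_converge[OF step] q by auto
  have "summable (\<lambda>j. C * q ^ j)" using q by (intro summable_mult summable_geometric) simp
  then have "summable (\<lambda>j. norm (z (Suc j) - z j))"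
    by (rule summable_comparison_test') (simp add: step)
  with q zb show thesis by (intro that)
qed

lemma geometric_in_bigo_powr:
  fixes q :: real
  assumes q: "0 < q" "q < 1" and e: "\<And>j. norm (e j) \<le> C * q ^ j"
  shows "(\<lambda>j. norm (e j)) \<in> O(\<lambda>j. real j powr s)"
proof -
  have "(\<lambda>j. norm (e j)) \<in> O(\<lambda>j. q ^ j)"
    by (rule bigoI[of _ C]) (use e q in simp)
  also have "(\<lambda>j. q ^ j) \<in> O(\<lambda>j. real j powr s)"
    using q by real_asymp
  finally show ?thesis .
qed

section \<open>Stationarity of limits\<close>

lemma tendsto_matrix_vector_mult:
  fixes A :: "'b \<Rightarrow> real^'d^'n"
  assumes "(A \<longlongrightarrow> A') F" "(h \<longlongrightarrow> h') F"
  shows "((\<lambda>j. A j *v h j) \<longlongrightarrow> A' *v h') F"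
  unfolding matrix_vector_mult_def
  by (intro tendsto_vec_lambda tendsto_sum tendsto_mult tendsto_vec_nth assms)

lemma tendsto_transpose:
  fixes A :: "'b \<Rightarrow> real^'d^'n"
  assumes "(A \<longlongrightarrow> A') F"
  shows "((\<lambda>j. transpose (A j)) \<longlongrightarrow> transpose A') F"
  unfolding transpose_def
  by (intro tendsto_vec_lambda tendsto_vec_nth assms)

lemma limit_stationary:
  fixes l :: "real^'d \<Rightarrow> real^'n"
  assumes k: "0 < \<mu> + \<alpha> * c" and \<eta>: "0 < \<eta>" and \<rho>: "0 < \<rho>" and L: "0 \<le> L"
    and J: "\<And>u h. norm (Jac l u *v h) \<le> L * norm h"
    and l: "\<And>u. l differentiable (at u)" and C1: "continuous_on UNIV (\<lambda>u. Jac l u)"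
    and g: "convex_on UNIV g"
    and z: "z = pd_seq l g x \<tau> \<alpha> c \<mu> \<rho> \<eta>" and lim: "z \<longlonglongrightarrow> (ub, pb)"
  shows "pb \<in> convex_subdiff g (l ub + c *\<^sub>R (\<tau> + \<alpha> *\<^sub>R pb))"
    and "c *\<^sub>R (x - \<alpha> *\<^sub>R ub) = transpose (Jac l ub) *v pb + \<mu> *\<^sub>R ub"
proof -
  have u: "(\<lambda>j. fst (z j)) \<longlonglongrightarrow> ub" using tendsto_fst[OF lim] by simp
  have p: "(\<lambda>j. snd (z j)) \<longlonglongrightarrow> pb" using tendsto_snd[OF lim] by simp
  have u': "(\<lambda>j. fst (z (Suc j))) \<longlonglongrightarrow> ub" using LIMSEQ_Suc[OF u] .
  have p': "(\<lambda>j. snd (z (Suc j))) \<longlonglongrightarrow> pb" using LIMSEQ_Suc[OF p] .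
  have lu: "(\<lambda>j. l (fst (z j))) \<longlonglongrightarrow> l ub"
    using isCont_tendsto_compose[OF differentiable_imp_continuous_within[OF l] u] .
  have "isCont (\<lambda>u. Jac l u) ub"
    using C1 by (simp add: continuous_on_eq_continuous_at)
  then have Ju: "(\<lambda>j. Jac l (fst (z j))) \<longlonglongrightarrow> Jac l ub"
    using u by (rule isCont_tendsto_compose)

  define y where "y j = (dual_arg l \<tau> \<alpha> c \<rho> (fst (z j)) (snd (z j)) - snd (z (Suc j))) /\<^sub>R \<rho>" for j
  have "y \<longlonglongrightarrow> (dual_arg l \<tau> \<alpha> c \<rho> ub pb - pb) /\<^sub>R \<rho>"
    unfolding y_def dual_arg_def by (intro tendsto_intros u p p' lu)
  also have "(dual_arg l \<tau> \<alpha> c \<rho> ub pb - pb) /\<^sub>R \<rho> = l ub + c *\<^sub>R (\<tau> + \<alpha> *\<^sub>R pb)"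
    using \<rho> by (simp add: dual_arg_def)
  finally have y: "y \<longlonglongrightarrow> l ub + c *\<^sub>R (\<tau> + \<alpha> *\<^sub>R pb)" .
  have "snd (z (Suc j)) \<in> convex_subdiff g (y j)" for j
    unfolding y_def using pd_seq_Suc(1)[OF k _ z, of j] \<eta> prox_conjugate(2)[OF g \<rho>] by simp
  then show "pb \<in> convex_subdiff g (l ub + c *\<^sub>R (\<tau> + \<alpha> *\<^sub>R pb))"
    by (rule convex_subdiff_closed_graph[OF g p' y])

  define r where "r j = resid l x \<alpha> c \<mu> (fst (z j)) (snd (z (Suc j)))" for j
  have "(\<lambda>j. (\<mu> + \<alpha> * c + L\<^sup>2) * norm (fst (z (Suc j)) - fst (z j)) / \<eta>)
      \<longlonglongrightarrow> (\<mu> + \<alpha> * c + L\<^sup>2) * norm (ub - ub) / \<eta>"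
    by (intro tendsto_intros u u') (use \<eta> in simp)
  moreover have "norm (r j) \<le> (\<mu> + \<alpha> * c + L\<^sup>2) * norm (fst (z (Suc j)) - fst (z j)) / \<eta>" for j
    using norm_Bmat_mult_le[OF J L k, of "fst (z j)" "fst (z (Suc j)) - fst (z j)"]
      pd_seq_Suc(2)[OF k _ z, of j] \<eta> by (simp add: r_def divide_right_mono)
  ultimately have "r \<longlonglongrightarrow> 0"
    by (intro Lim_null_comparison[of r]) (auto intro: always_eventually)
  moreover have "r \<longlonglongrightarrow> resid l x \<alpha> c \<mu> ub pb"
    unfolding r_def resid_def
    by (intro tendsto_intros tendsto_matrix_vector_mult tendsto_transpose u p' Ju)
  ultimately have "resid l x \<alpha> c \<mu> ub pb = 0" by (blast intro: LIMSEQ_unique)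
  then show "c *\<^sub>R (x - \<alpha> *\<^sub>R ub) = transpose (Jac l ub) *v pb + \<mu> *\<^sub>R ub"
    by (simp add: resid_def)
qed

section \<open>Convergence of the primal--dual iteration\<close>

theorem theorem3p15:
  fixes l :: "real^'d \<Rightarrow> real^'n" and g :: "real^'n \<Rightarrow> real"
    and x :: "real^'d" and \<tau> :: "real^'n"
    and L\<^sub>J L\<^sub>H \<alpha> c \<mu> \<rho> \<eta> a b :: real
    and z :: "nat \<Rightarrow> (real^'d) \<times> (real^'n)"
    and \<Psi> :: "(real^'d) \<times> (real^'n) \<Rightarrow> real"
  assumes l_proper: "\<And>i. proper_fun (\<lambda>u. ereal (l u $ i))"
    and l_lsc: "\<And>i. lsc_fun (\<lambda>u. ereal (l u $ i))"
    and l_diff: "\<And>u. l differentiable (at u)"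
    and l_C1: "continuous_on UNIV (\<lambda>u. Jac l u)"
    and L_pos: "0 < L\<^sub>J" "0 < L\<^sub>H"
    and Jac_bound: "\<And>u. mat_norm2 (Jac l u) \<le> L\<^sub>J"
    and Jac_lipschitz: "\<And>u v. mat_norm2 (Jac l u - Jac l v) \<le> L\<^sub>H * norm (u - v)"
    and g_convex: "convex_on UNIV g"
    and g_proper: "proper_fun (\<lambda>y. ereal (g y))"
    and g_lsc: "lsc_fun (\<lambda>y. ereal (g y))"
    and g_mono: "\<And>y w. (\<forall>i. w $ i < y $ i) \<Longrightarrow> g w < g y"
    and dom_bounded: "bounded (eff_dom (conjugate g))"
    and pos: "0 < \<alpha>" "0 < c" "0 < \<mu>"
    and rho: "0 < \<rho>" "\<rho> < 1 / L\<^sub>J\<^sup>2"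
    and eta: "0 < \<eta>" "\<eta> \<le> 1"
    and z_eq: "z = pd_seq l g x \<tau> \<alpha> c \<mu> \<rho> \<eta>"
    and Psi_eq: "\<Psi> = merit l g x \<tau> \<alpha> c \<mu> \<rho>"
    and ab_pos: "0 < a" "0 < b"
    and descent: "\<And>j. \<Psi> (z (Suc j)) \<le> \<Psi> (z j) - a * (norm (z (Suc j) - z j))\<^sup>2"
    and rel_error: "\<And>j. dist_zero (limiting_subdiff (\<lambda>w. ereal (\<Psi> w)) (z (Suc j)))
                          \<le> ereal (b * norm (z (Suc j) - z j))"
  shows
    "((\<forall>j. (\<exists>!p. is_prox \<rho> (conjugate g) (dual_arg l \<tau> \<alpha> c \<rho> (fst (z j)) (snd (z j))) p)
           \<and> invertible (Bmat l \<alpha> c \<mu> (fst (z j))))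
      \<and> bounded (range z)
      \<and> (\<forall>j. \<Psi> (z (Suc j)) \<le> \<Psi> (z j)))
     \<and>
     (\<forall>ub pb r. strict_mono r \<and> (z \<circ> r) \<longlonglongrightarrow> (ub, pb) \<longrightarrow>
        pb \<in> convex_subdiff g (l ub + c *\<^sub>R (\<tau> + \<alpha> *\<^sub>R pb))
        \<and> c *\<^sub>R (x - \<alpha> *\<^sub>R ub) = transpose (Jac l ub) *v pb + \<mu> *\<^sub>R ub)
     \<and>
     (\<exists>ub pb. z \<longlonglongrightarrow> (ub, pb)
        \<and> (\<forall>\<theta>. KL_exponent (\<lambda>w. ereal (\<Psi> w)) (ub, pb) \<theta> \<longrightarrow>
             (\<theta> = 0 \<longrightarrow> summable (\<lambda>j. norm (z (Suc j) - z j)))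
             \<and> (\<theta> = 1 / 2 \<longrightarrow>
                  (\<exists>C q. 0 < q \<and> q < 1 \<and> (\<forall>j. norm (z j - (ub, pb)) \<le> C * q ^ j)))
             \<and> (1 / 2 < \<theta> \<and> \<theta> < 1 \<longrightarrow>
                  (\<lambda>j. norm (z j - (ub, pb)))
                    \<in> O(\<lambda>j. real j powr (- ((1 - \<theta>) / (2 * \<theta> - 1)))))))"
proof -
  have k: "0 < \<mu> + \<alpha> * c" using pos by (simp add: add_pos_pos)
  have J: "norm (Jac l u *v h) \<le> L\<^sub>J * norm h" for u h
    using norm_matrix_vector_le_mat_norm2[of "Jac l u" h] Jac_bound[of u]
    by (meson mult_right_mono norm_ge_zero order_trans)
  define K where "K = ((\<mu> + \<alpha> * c + L\<^sub>J\<^sup>2) / \<eta> + L\<^sub>J)\<^sup>2 / (2 * (\<mu> + \<alpha> * c)) + 1 / (2 * \<rho>\<^sup>2)"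
  have K: "0 < K" unfolding K_def using k rho(1) by (intro add_nonneg_pos) auto
  have comparable: "\<Psi> (z j) \<le> K * (norm (z (Suc j) - z j))\<^sup>2" for j
    unfolding Psi_eq K_def by (rule merit_le_step[OF k eta(1) less_imp_le[OF L_pos(1)] J z_eq])
  have nonneg: "0 \<le> \<Psi> (z j)" for j unfolding Psi_eq by (rule merit_nonneg)
  obtain zb C q where q: "0 < q" "q < 1" and lim: "z \<longlonglongrightarrow> zb"
    and rate: "\<And>j. norm (z j - zb) \<le> C * q ^ j"
    and fin: "summable (\<lambda>j. norm (z (Suc j) - z j))"
    using comparable_descent_linear_convergence[of "\<lambda>j. \<Psi> (z j)", OF nonneg ab_pos(1) K descent comparable] by metis
  obtain u\<^sub>0 p\<^sub>0 where zb: "zb = (u\<^sub>0, p\<^sub>0)" by (cases zb)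
  have "0 \<le> a * (norm (z (Suc j) - z j))\<^sup>2" for j using ab_pos by simp
  then have decreasing: "\<Psi> (z (Suc j)) \<le> \<Psi> (z j)" for j
    using descent[of j] by (smt (verit))
  have part1: "(\<forall>j. (\<exists>!p. is_prox \<rho> (conjugate g) (dual_arg l \<tau> \<alpha> c \<rho> (fst (z j)) (snd (z j))) p)
           \<and> invertible (Bmat l \<alpha> c \<mu> (fst (z j))))
      \<and> bounded (range z)
      \<and> (\<forall>j. \<Psi> (z (Suc j)) \<le> \<Psi> (z j))"
    by (intro conjI allI prox_conjugate(1)[OF g_convex rho(1)] invertible_Bmat[OF k] decreasing
        convergent_imp_bounded[OF lim])
  have stationary: "pb \<in> convex_subdiff g (l ub + c *\<^sub>R (\<tau> + \<alpha> *\<^sub>R pb))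
      \<and> c *\<^sub>R (x - \<alpha> *\<^sub>R ub) = transpose (Jac l ub) *v pb + \<mu> *\<^sub>R ub"
    if "strict_mono r" "(z \<circ> r) \<longlonglongrightarrow> (ub, pb)" for ub pb and r :: "nat \<Rightarrow> nat"
  proof -
    \<comment> \<open>The full sequence converges, so a cluster point is its limit.\<close>
    have "zb = (ub, pb)"
      using LIMSEQ_subseq_LIMSEQ[OF lim that(1)] that(2) by (rule LIMSEQ_unique)
    then have "z \<longlonglongrightarrow> (ub, pb)" using lim by simp
    then show ?thesis
      using limit_stationary[OF k eta(1) rho(1) less_imp_le[OF L_pos(1)] J l_diff l_C1 g_convex z_eq]
      by blast
  qed
  have part2: "\<forall>ub pb r. strict_mono r \<and> (z \<circ> r) \<longlonglongrightarrow> (ub, pb) \<longrightarrow>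
        pb \<in> convex_subdiff g (l ub + c *\<^sub>R (\<tau> + \<alpha> *\<^sub>R pb))
        \<and> c *\<^sub>R (x - \<alpha> *\<^sub>R ub) = transpose (Jac l ub) *v pb + \<mu> *\<^sub>R ub"
    by (intro allI impI, elim conjE) (rule stationary)
  have powr_rate: "(\<lambda>j. norm (z j - zb)) \<in> O(\<lambda>j. real j powr s)" for s
    by (rule geometric_in_bigo_powr[OF q rate])
  have "\<exists>C q. 0 < q \<and> q < 1 \<and> (\<forall>j. norm (z j - zb) \<le> C * q ^ j)"
    using q rate by blast
  with lim fin powr_rate have part3: "\<exists>ub pb. z \<longlonglongrightarrow> (ub, pb)
        \<and> (\<forall>\<theta>. KL_exponent (\<lambda>w. ereal (\<Psi> w)) (ub, pb) \<theta> \<longrightarrow>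
             (\<theta> = 0 \<longrightarrow> summable (\<lambda>j. norm (z (Suc j) - z j)))
             \<and> (\<theta> = 1 / 2 \<longrightarrow>
                  (\<exists>C q. 0 < q \<and> q < 1 \<and> (\<forall>j. norm (z j - (ub, pb)) \<le> C * q ^ j)))
             \<and> (1 / 2 < \<theta> \<and> \<theta> < 1 \<longrightarrow>
                  (\<lambda>j. norm (z j - (ub, pb)))
                    \<in> O(\<lambda>j. real j powr (- ((1 - \<theta>) / (2 * \<theta> - 1))))))"
    unfolding zb by blast
  show ?thesis by (rule conjI[OF part1 conjI[OF part2 part3]])
qed

end
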